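(* Let $V$ be a real vector space of dimension $n$, and let $\mathcal F_\mu(V)\subseteq\mathfrak X(V)$ be the singular foliation given by the linear action of $\mathfrak{sl}(V)$ on $V$, i.e. $\mathcal F_\mu(V)=\rho(\Gamma(\mathfrak{sl}(V)))$. For $i=1,\dots,n$ let $K_i\subseteq\wedge^iV^*\otimes V$ be defined by $K_i:=\ker(\phi_i)$, where $\phi_i:\wedge^iV^*\otimes V\to\wedge^{i-1}V^*$, $\phi_i(\alpha\otimes v)=(-1)^{i-1}\iota_v(\alpha)$. The sequence $$0\to\Gamma(\wedge^nV^* )\xrightarrow{\,d_n\phi_n^{-1}\partial_n\,}\Gamma(K_{n-1})\xrightarrow{d_{n-1}}\cdots\xrightarrow{d_2}\Gamma(K_1)\xrightarrow{\rho_\mu}\mathcal F_\mu(V)\to0$$ is exact, where $\rho_\mu=\rho|_{\Gamma(K_1)}$.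
   Context: For a finite-dimensional real vector space $U$, $\Gamma(U)=C^\infty(V,U)$ denotes the global sections of the trivial bundle $U\times V\to V$; linear maps such as $\phi_i$ are extended $C^\infty(V)$-linearly to sections (constant extension). The map $\phi_n$ is an isomorphism, and $\phi_n^{-1}$ denotes its inverse. Let $\{e_i\}$ be a basis of $V$ with linear coordinates $x^i$ (repeated indices are summed). The maps are: $d_k:\Gamma(\wedge^kV^*\otimes V)\to\Gamma(\wedge^{k-1}V^*\otimes V)$, $d_k(\alpha\otimes v)=x^i\iota_{e_i}(\alpha)\otimes v$; $\rho:\Gamma(V^*\otimes V)\to\mathfrak X(V)$, $\rho(\alpha\otimes v)=x^i\alpha(e_i)\,\partial_v$, where $\partial_v$ is the constant vector field with value $v$; and $\partial_k:\Gamma(\wedge^kV^* )\to\Gamma(\wedge^{k-1}V^* )$, $\partial_k(\alpha)=-x^i\iota_{e_i}(\alpha)$. Here $\phi_1$ is the trace on $V^*\otimes V=\mathfrak{gl}(V)$, so $K_1=\mathfrak{sl}(V)$, the traceless endomorphisms. The subscript $\mu$ refers to a nonzero element $\mu\in\wedge^nV^*$. *)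

theory Defs
  imports "HOL-Analysis.Analysis" "HOL-Library.Function_Algebras"
begin

text \<open>
  The vector space \<open>V\<close> is a type \<open>'v::euclidean_space\<close>; its dimension is \<open>DIM('v)\<close>, the basis
  \<open>e\<^sub>i\<close> is \<open>Basis\<close>, and the linear coordinate belonging to \<open>b \<in> Basis\<close> is \<open>x \<bullet> b\<close>.
  The Euclidean structure serves only to name a basis with its coordinates and to speak of
  smoothness. By \<open>contr_expansion\<close> and \<open>phi_tensor\<close> below, the maps do not depend on the basis.
\<close>

section \<open>Alternating multilinear maps\<close>

text \<open>
  An alternating \<open>k\<close>-linear map takes the list of its \<open>k\<close> arguments; it is extended by \<open>0\<close> to
  lists of any other length, so that equality of functions is equality of forms.
\<close>

definition alternating_maps :: "nat \<Rightarrow> ('v::real_vector list \<Rightarrow> 'b::real_vector) set" where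
  "alternating_maps k = {\<alpha>.
     (\<forall>ws. length ws \<noteq> k \<longrightarrow> \<alpha> ws = 0) \<and>
     (\<forall>ws i. length ws = k \<longrightarrow> i < k \<longrightarrow> linear (\<lambda>v. \<alpha> (ws[i := v]))) \<and>
     (\<forall>ws. length ws = k \<longrightarrow> \<not> distinct ws \<longrightarrow> \<alpha> ws = 0)}"

definition ext_power :: "nat \<Rightarrow> ('v::real_vector list \<Rightarrow> real) set" where
  "ext_power k = alternating_maps k"

text \<open>
  \<open>\<And>\<^sup>kV\<^sup>* \<otimes> V\<close> is the space of \<open>V\<close>-valued alternating \<open>k\<close>-linear maps, where \<open>\<alpha> \<otimes> v\<close> is the map
  \<open>ws \<mapsto> \<alpha>(ws) v\<close>. By \<open>tensor_expansion\<close> below, the decomposable tensors span this space.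
\<close>

definition ext_power_tensor :: "nat \<Rightarrow> ('v::real_vector list \<Rightarrow> 'v) set" where
  "ext_power_tensor k = alternating_maps k"

definition tensor :: "('v list \<Rightarrow> real) \<Rightarrow> 'v::real_vector \<Rightarrow> ('v list \<Rightarrow> 'v)" (infixr \<open>\<otimes>\<^sub>V\<close> 75) where
  "\<alpha> \<otimes>\<^sub>V v = (\<lambda>ws. \<alpha> ws *\<^sub>R v)"

definition contr :: "'v \<Rightarrow> ('v list \<Rightarrow> 'b) \<Rightarrow> ('v list \<Rightarrow> 'b)" where
  "contr v \<alpha> = (\<lambda>ws. \<alpha> (v # ws))"

text \<open>
  The map \<open>\<phi>\<^sub>k(\<alpha> \<otimes> v) = (-1)\<^bsup>k-1\<^esup> \<iota>\<^sub>v \<alpha>\<close>, extended linearly by writing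
  \<open>T = \<Sum>\<^sub>b (T \<bullet> b) \<otimes> b\<close>; see \<open>phi_tensor\<close>.
\<close>

definition phi :: "nat \<Rightarrow> ('v::euclidean_space list \<Rightarrow> 'v) \<Rightarrow> ('v list \<Rightarrow> real)" where
  "phi k T = (\<lambda>ws. \<Sum>b\<in>Basis. (-1) ^ (k - 1) * contr b (\<lambda>us. T us \<bullet> b) ws)"

definition K_ker :: "nat \<Rightarrow> ('v::euclidean_space list \<Rightarrow> 'v) set" where
  "K_ker k = {T \<in> ext_power_tensor k. phi k T = 0}"

text \<open>Endomorphisms are elements of \<open>V\<^sup>* \<otimes> V\<close>, that is, linear maps \<open>[v] \<mapsto> A v\<close>.\<close>

definition sl :: "('v::euclidean_space list \<Rightarrow> 'v) set" where
  "sl = {A \<in> ext_power_tensor 1. (\<Sum>b\<in>Basis. A [b] \<bullet> b) = 0}"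

section \<open>Smooth sections\<close>

primrec times_differentiable :: "nat \<Rightarrow> ('v::real_normed_vector \<Rightarrow> 'b::real_normed_vector) \<Rightarrow> bool" where
  "times_differentiable 0 f \<longleftrightarrow> continuous_on UNIV f"
| "times_differentiable (Suc m) f \<longleftrightarrow>
     (\<forall>x. f differentiable at x) \<and>
     (\<forall>v. times_differentiable m (\<lambda>x. frechet_derivative f (at x) v))"

definition smooth :: "('v::real_normed_vector \<Rightarrow> 'b::real_normed_vector) \<Rightarrow> bool" where
  "smooth f \<longleftrightarrow> (\<forall>m. times_differentiable m f)"

text \<open>
  For a finite-dimensional space \<open>U\<close> of multilinear maps the evaluations at lists span the dual
  of \<open>U\<close>, so a map into \<open>U\<close> is smooth iff all its evaluations are.
\<close>

definition sections ::
    "('v::real_normed_vector list \<Rightarrow> 'b::real_normed_vector) set \<Rightarrow> ('v \<Rightarrow> 'v list \<Rightarrow> 'b) set" (\<open>\<Gamma>\<close>) where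
  "\<Gamma> U = {s. (\<forall>x. s x \<in> U) \<and> (\<forall>ws. smooth (\<lambda>x. s x ws))}"

section \<open>The maps between sections\<close>

text \<open>
  The formulas for \<open>d\<^sub>k\<close> and \<open>\<partial>\<^sub>k\<close> are the same in all degrees, so the degree is not a parameter.
\<close>

definition d_map :: "('v::euclidean_space \<Rightarrow> 'v list \<Rightarrow> 'v) \<Rightarrow> ('v \<Rightarrow> 'v list \<Rightarrow> 'v)" where
  "d_map s = (\<lambda>x ws. \<Sum>b\<in>Basis. (x \<bullet> b) *\<^sub>R contr b (s x) ws)"

definition bdry :: "('v::euclidean_space \<Rightarrow> 'v list \<Rightarrow> real) \<Rightarrow> ('v \<Rightarrow> 'v list \<Rightarrow> real)" where
  "bdry s = (\<lambda>x ws. - (\<Sum>b\<in>Basis. (x \<bullet> b) * contr b (s x) ws))"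

text \<open>Vector fields on \<open>V\<close> are maps \<open>V \<Rightarrow> V\<close>; \<open>\<partial>\<^sub>v\<close> is the constant map with value \<open>v\<close>.\<close>

definition rho :: "('v::euclidean_space \<Rightarrow> 'v list \<Rightarrow> 'v) \<Rightarrow> ('v \<Rightarrow> 'v)" where
  "rho s = (\<lambda>x. \<Sum>b\<in>Basis. (x \<bullet> b) *\<^sub>R s x [b])"

definition phi_inv :: "nat \<Rightarrow> ('v::euclidean_space \<Rightarrow> 'v list \<Rightarrow> real) \<Rightarrow> ('v \<Rightarrow> 'v list \<Rightarrow> 'v)" where
  "phi_inv k s = (\<lambda>x. inv_into (ext_power_tensor k) (phi k) (s x))"

definition F_mu :: "('v::euclidean_space \<Rightarrow> 'v) set" where
  "F_mu = rho ` \<Gamma> sl"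

section \<open>Exactness\<close>

text \<open>Exactness of \<open>A \<rightarrow> B \<rightarrow> C\<close> at \<open>B\<close>.\<close>

definition exact_at ::
    "'a set \<Rightarrow> ('a \<Rightarrow> 'b) \<Rightarrow> 'b set \<Rightarrow> ('b \<Rightarrow> 'c::zero) \<Rightarrow> 'c set \<Rightarrow> bool" where
  "exact_at A f B g C \<longleftrightarrow> f ` A \<subseteq> B \<and> g ` B \<subseteq> C \<and> f ` A = {b \<in> B. g b = 0}"

section \<open>Agreement with the defining formulas on decomposable tensors\<close>

lemma alternating_maps_linear_comp:
  assumes "T \<in> alternating_maps k" "linear f"
  shows "(\<lambda>ws. f (T ws)) \<in> alternating_maps k"
  using assms linear_compose[of _ f, unfolded o_def]
  by (auto simp: alternating_maps_def linear_0)

lemma tensor_in: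
  assumes "\<alpha> \<in> ext_power k"
  shows "\<alpha> \<otimes>\<^sub>V v \<in> ext_power_tensor k"
  using alternating_maps_linear_comp[of \<alpha> k "\<lambda>r. r *\<^sub>R v"] assms
  by (simp add: ext_power_def ext_power_tensor_def tensor_def linear_scaleR_left)

lemma tensor_expansion:
  fixes T :: "'v::euclidean_space list \<Rightarrow> 'v"
  assumes "T \<in> ext_power_tensor k"
  shows "\<And>b. (\<lambda>ws. T ws \<bullet> b) \<in> ext_power k"
    and "T = (\<lambda>ws. \<Sum>b\<in>Basis. ((\<lambda>us. T us \<bullet> b) \<otimes>\<^sub>V b) ws)"
  using alternating_maps_linear_comp[of T k "\<lambda>v. v \<bullet> b" for b] assms
  by (simp_all add: ext_power_def ext_power_tensor_def tensor_def euclidean_representation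
      bounded_linear.linear[OF bounded_linear_inner_left])

lemma contr_expansion:
  fixes v :: "'v::euclidean_space" and \<alpha> :: "'v list \<Rightarrow> 'b::real_vector"
  assumes "\<alpha> \<in> alternating_maps k"
  shows "contr v \<alpha> = (\<lambda>ws. \<Sum>b\<in>Basis. (v \<bullet> b) *\<^sub>R contr b \<alpha> ws)"
proof
  fix ws :: "'v list"
  show "contr v \<alpha> ws = (\<Sum>b\<in>Basis. (v \<bullet> b) *\<^sub>R contr b \<alpha> ws)"
  proof (cases "Suc (length ws) = k")
    case True
    then have "linear (\<lambda>u. \<alpha> ((v # ws)[0 := u]))"
      using assms unfolding alternating_maps_def by (auto simp del: list_update.simps)
    then have lin: "linear (\<lambda>u. \<alpha> (u # ws))"
      by simp
    have "\<alpha> (v # ws) = \<alpha> ((\<Sum>b\<in>Basis. (v \<bullet> b) *\<^sub>R b) # ws)"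
      by (simp only: euclidean_representation)
    also have "\<dots> = (\<Sum>b\<in>Basis. (v \<bullet> b) *\<^sub>R \<alpha> (b # ws))"
      by (simp only: linear_sum[OF lin] linear_scale[OF lin])
    finally show ?thesis
      by (simp add: contr_def)
  next
    case False
    then show ?thesis
      using assms by (auto simp: contr_def alternating_maps_def)
  qed
qed

lemma phi_tensor:
  assumes "\<alpha> \<in> ext_power k"
  shows "phi k (\<alpha> \<otimes>\<^sub>V v) = (\<lambda>ws. (-1) ^ (k - 1) * contr v \<alpha> ws)"
  using contr_expansion[of \<alpha> k v] assms
  by (simp add: phi_def tensor_def contr_def ext_power_def sum_distrib_left mult_ac)

lemma d_tensor:
  "d_map (\<lambda>x. \<alpha> x \<otimes>\<^sub>V v) =
     (\<lambda>x. (\<lambda>ws. \<Sum>b\<in>Basis. (x \<bullet> b) * contr b (\<alpha> x) ws) \<otimes>\<^sub>V v)"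
  by (simp add: d_map_def tensor_def contr_def scaleR_sum_left)

lemma rho_tensor:
  "rho (\<lambda>x. \<alpha> x \<otimes>\<^sub>V v) = (\<lambda>x. (\<Sum>b\<in>Basis. (x \<bullet> b) * \<alpha> x [b]) *\<^sub>R v)"
  by (simp add: rho_def tensor_def scaleR_sum_left)

lemma K_ker_1_eq_sl: "K_ker 1 = sl"
proof -
  have "phi 1 T = 0 \<longleftrightarrow> (\<Sum>b\<in>Basis. T [b] \<bullet> b) = 0"
    if "T \<in> ext_power_tensor 1" for T :: "'a list \<Rightarrow> 'a"
  proof
    assume "phi 1 T = 0"
    from fun_cong[OF this, of "[]"] show "(\<Sum>b\<in>Basis. T [b] \<bullet> b) = 0"
      by (simp add: phi_def contr_def)
  next
    assume *: "(\<Sum>b\<in>Basis. T [b] \<bullet> b) = 0"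
    show "phi 1 T = 0"
    proof
      fix ws
      show "phi 1 T ws = 0 ws"
        using that * by (cases ws)
          (auto simp: phi_def contr_def ext_power_tensor_def alternating_maps_def)
    qed
  qed
  then show ?thesis
    by (auto simp: K_ker_def sl_def)
qed

end

theory Submission
  imports Defs
begin

text \<open>
  Let \<open>\<iota>\<^sub>E\<close> be the contraction with the Euler vector field \<open>E(x) = x\<close>. The maps \<open>d\<^sub>k\<close> are \<open>\<iota>\<^sub>E\<close> on forms with
  values in \<open>V\<close>, \<open>\<partial>\<^sub>k\<close> is \<open>-\<iota>\<^sub>E\<close> on scalar forms, and \<open>\<rho>\<close> is \<open>\<iota>\<^sub>E\<close> in degree \<open>1\<close>. Forms with \<open>\<iota>\<^sub>E\<close> make up the Koszul
  complex of the coordinate functions \<open>x\<^sup>1, \<dots>, x\<^sup>n\<close>. It is exact in positive degrees (\<open>koszul_exact\<close>): by Cartan's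
  formula \<open>d \<circ> L\<^sub>E\<^sup>-\<^sup>1\<close> is a contracting homotopy for \<open>\<iota>\<^sub>E\<close>, where the Lie derivative \<open>L\<^sub>E\<close> is inverted by averaging along rays,
  an operation that preserves smoothness.

  The map \<open>\<phi>\<^sub>k\<close> is, up to sign, the trace contraction of \<open>V\<close> with the first form slot, which anticommutes with \<open>\<iota>\<^sub>E\<close>
  (\<open>trace_sec_euler_contr\<close>). So the kernels \<open>K\<^sub>k\<close> form a subcomplex of the \<open>V\<close>-valued Koszul complex, and the quotient is a
  part of the scalar one, shifted by one degree. The trace contraction is onto in all relevant degrees, and bijective
  in degree \<open>n\<close>, because the wedge with \<open>id\<^sub>V\<close> is an inverse up to the factors of \<open>trace_contr_wedge_id\<close>.

  Now let \<open>s\<close> be a section of \<open>K\<^sub>k\<close> with \<open>\<iota>\<^sub>E s = 0\<close> and \<open>0 < k < n\<close>. It has a primitive \<open>t\<close>, whose trace is a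
  cycle and hence equals \<open>\<iota>\<^sub>E u\<close>. If \<open>k + 1 < n\<close>, then \<open>u\<close> is the trace of some \<open>r\<close>, and \<open>t + \<iota>\<^sub>E r\<close> is a traceless
  primitive (\<open>kernel_complex_exact\<close>). If \<open>k + 1 = n\<close>, then \<open>t\<close> is \<open>\<phi>\<^sub>n\<^sup>-\<^sup>1 \<partial>\<^sub>n u\<close> up to sign, so \<open>s\<close> lies in the
  image of the first map of the sequence (\<open>connecting_map_onto_kernel\<close>). That map is injective since \<open>\<iota>\<^sub>E\<close> is injective in
  degree \<open>n\<close>, both on scalar and on \<open>V\<close>-valued forms (\<open>connecting_map_injective\<close>).
\<close>

section \<open>Alternating maps\<close>

text \<open>
  Writing the slot of linearity as \<open>xs @ v # ys\<close> instead of by its index suits inductions over lists.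
\<close>

lemma alternating_maps_iff:
  "\<alpha> \<in> alternating_maps k \<longleftrightarrow>
     (\<forall>ws. length ws \<noteq> k \<longrightarrow> \<alpha> ws = 0) \<and>
     (\<forall>xs ys. Suc (length xs + length ys) = k \<longrightarrow> linear (\<lambda>v. \<alpha> (xs @ v # ys))) \<and>
     (\<forall>ws. \<not> distinct ws \<longrightarrow> \<alpha> ws = 0)"
  (is "?L \<longleftrightarrow> ?R")
proof
  assume L: ?L
  have "linear (\<lambda>v. \<alpha> (xs @ v # ys))" if "Suc (length xs + length ys) = k" for xs ys
  proof -
    have "length (xs @ 0 # ys) = k" "length xs < k" using that by auto
    then have "linear (\<lambda>v. \<alpha> ((xs @ 0 # ys)[length xs := v]))"
      using L unfolding alternating_maps_def by blast
    then show ?thesis by simp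
  qed
  moreover have "\<forall>ws. \<not> distinct ws \<longrightarrow> \<alpha> ws = 0"
    using L unfolding alternating_maps_def by blast
  ultimately show ?R using L unfolding alternating_maps_def by blast
next
  assume R: ?R
  have "linear (\<lambda>v. \<alpha> (ws[i := v]))" if "length ws = k" "i < k" for ws i
  proof -
    have "Suc (length (take i ws) + length (drop (Suc i) ws)) = k" using that by simp
    then have "linear (\<lambda>v. \<alpha> (take i ws @ v # drop (Suc i) ws))" using R by blast
    then show ?thesis using that by (simp add: upd_conv_take_nth_drop)
  qed
  then show ?L using R unfolding alternating_maps_def by blast
qed

lemma alternating_length: "\<alpha> \<in> alternating_maps k \<Longrightarrow> length ws \<noteq> k \<Longrightarrow> \<alpha> ws = 0"
  by (simp add: alternating_maps_iff)

lemma alternating_distinct: "\<alpha> \<in> alternating_maps k \<Longrightarrow> \<not> distinct ws \<Longrightarrow> \<alpha> ws = 0"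
  by (simp add: alternating_maps_iff)

lemma alternating_linear:
  assumes "\<alpha> \<in> alternating_maps k"
  shows "linear (\<lambda>v. \<alpha> (xs @ v # ys))"
proof (cases "Suc (length xs + length ys) = k")
  case True
  then show ?thesis using assms by (simp add: alternating_maps_iff)
next
  case False
  then have "(\<lambda>v. \<alpha> (xs @ v # ys)) = (\<lambda>v. 0)"
    using alternating_length[OF assms] by auto
  then show ?thesis by (simp add: linear_iff)
qed

lemma alternating_linear_hd:
  assumes "\<alpha> \<in> alternating_maps k"
  shows "linear (\<lambda>v. \<alpha> (v # ys))"
  using alternating_linear[OF assms, of "[]"] by simp

lemma alternating_mapsI:
  assumes "\<And>ws. length ws \<noteq> k \<Longrightarrow> \<alpha> ws = 0"
    and "\<And>xs ys. linear (\<lambda>v. \<alpha> (xs @ v # ys))"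
    and "\<And>ws. \<not> distinct ws \<Longrightarrow> \<alpha> ws = 0"
  shows "\<alpha> \<in> alternating_maps k"
  using assms by (simp add: alternating_maps_iff)

lemma alternating_swap:
  assumes "\<alpha> \<in> alternating_maps k"
  shows "\<alpha> (xs @ a # b # ys) = - \<alpha> (xs @ b # a # ys)"
proof -
  have l: "linear (\<lambda>v. \<alpha> (xs @ v # u # ys))" "linear (\<lambda>v. \<alpha> (xs @ u # v # ys))" for u
    using alternating_linear[OF assms, of xs "u # ys"] alternating_linear[OF assms, of "xs @ [u]" ys]
    by simp_all
  have d: "\<alpha> (xs @ u # u # ys) = 0" for u
    by (rule alternating_distinct[OF assms]) simp
  have "0 = \<alpha> (xs @ (a + b) # (a + b) # ys)"
    by (simp add: d)
  also have "\<dots> = \<alpha> (xs @ a # b # ys) + \<alpha> (xs @ b # a # ys)"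
    unfolding linear_add[OF l(1)] linear_add[OF l(2)] by (simp add: d)
  finally show ?thesis by (metis eq_neg_iff_add_eq_0)
qed

lemma alternating_move:
  assumes "\<alpha> \<in> alternating_maps k"
  shows "\<alpha> (xs @ a # ys) = (-1) ^ length xs *\<^sub>R \<alpha> (a # xs @ ys)"
proof (induction xs arbitrary: ys rule: rev_induct)
  case (snoc x xs)
  have "\<alpha> ((xs @ [x]) @ a # ys) = - \<alpha> (xs @ a # x # ys)"
    using alternating_swap[OF assms, of xs x a ys] by simp
  then show ?case using snoc[of "x # ys"] by simp
qed simp

lemma alternating_expand:
  fixes \<alpha> :: "'v::euclidean_space list \<Rightarrow> 'b::real_vector"
  assumes "\<alpha> \<in> alternating_maps k"
  shows "\<alpha> (xs @ v # ys) = (\<Sum>b\<in>Basis. (v \<bullet> b) *\<^sub>R \<alpha> (xs @ b # ys))"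
proof -
  note l = alternating_linear[OF assms, of xs ys]
  have "\<alpha> (xs @ v # ys) = \<alpha> (xs @ (\<Sum>b\<in>Basis. (v \<bullet> b) *\<^sub>R b) # ys)"
    by (simp add: euclidean_representation)
  then show ?thesis
    by (simp only: linear_sum[OF l] linear_scale[OF l])
qed

text \<open>
  On lists of basis vectors a repetition is forced by counting; multilinearity carries this over to
  arbitrary lists, one argument at a time from the left.
\<close>

lemma alternating_vanish_above_dim:
  fixes \<alpha> :: "'v::euclidean_space list \<Rightarrow> 'b::real_vector"
  assumes \<alpha>: "\<alpha> \<in> alternating_maps k" and k: "k > DIM('v)"
  shows "\<alpha> ws = 0"
proof -
  have "\<alpha> (xs @ ys) = 0" if "set xs \<subseteq> Basis" for xs ys :: "'v list"
    using that
  proof (induction ys arbitrary: xs)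
    case Nil
    have "card (set xs) \<le> DIM('v)"
      by (rule card_mono) (use Nil in auto)
    then have "length xs \<noteq> k \<or> \<not> distinct xs"
      using k distinct_card[of xs] by auto
    then show ?case
      using alternating_length[OF \<alpha>] alternating_distinct[OF \<alpha>] by auto
  next
    case (Cons y ys)
    have "\<alpha> (xs @ b # ys) = 0" if "b \<in> Basis" for b
      using Cons.IH[of "xs @ [b]"] Cons.prems that by simp
    then show ?case
      by (simp add: alternating_expand[OF \<alpha>, of xs y ys])
  qed
  from this[of "[]" ws] show ?thesis by simp
qed

lemma contr_alternating:
  assumes "\<alpha> \<in> alternating_maps k"
  shows "contr v \<alpha> \<in> alternating_maps (k - 1)"
proof (rule alternating_mapsI)
  show "linear (\<lambda>u. contr v \<alpha> (xs @ u # ys))" for xs ys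
    using alternating_linear[OF assms, of "v # xs" ys] by (simp add: contr_def)
next
  show "contr v \<alpha> ws = 0" if "length ws \<noteq> k - 1" for ws
    unfolding contr_def by (rule alternating_length[OF assms]) (use that in auto)
  show "contr v \<alpha> ws = 0" if "\<not> distinct ws" for ws
    unfolding contr_def by (rule alternating_distinct[OF assms]) (use that in auto)
qed

lemma contr_contr:
  assumes "\<alpha> \<in> alternating_maps k"
  shows "contr v (contr v \<alpha>) = 0"
  using alternating_distinct[OF assms] by (auto simp: contr_def)

lemma alternating_sum:
  assumes "\<And>i. i \<in> I \<Longrightarrow> f i \<in> alternating_maps k"
  shows "(\<lambda>ws. \<Sum>i\<in>I. f i ws) \<in> alternating_maps k"
  using assms
  by (intro alternating_mapsI linear_compose_sum ballI sum.neutral)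
     (auto intro: alternating_length alternating_distinct alternating_linear)

section \<open>Antisymmetrization\<close>

text \<open>
  Up to a constant factor this is the antisymmetrization of \<open>F\<close>: unfolding the recursion gives
  \<open>\<Sum>\<^sub>i (-1)\<^sup>i F(w\<^sub>i)(\<dots>, w\<^sub>i omitted, \<dots>)\<close>. It produces the exterior derivative when \<open>F v\<close> is the
  derivative of a form in direction \<open>v\<close>, and the wedge with \<open>id\<close> when \<open>F v = u \<otimes> v\<close>. The recursive form
  makes its properties provable by induction on the list of arguments, without index bookkeeping.
\<close>

fun alternate :: "('v \<Rightarrow> 'v list \<Rightarrow> 'b::real_vector) \<Rightarrow> 'v list \<Rightarrow> 'b" where
  "alternate F [] = 0"
| "alternate F (w # ws) = F w ws - alternate (\<lambda>v us. F v (w # us)) ws"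

lemma linear_alternate:
  assumes "linear f"
  shows "f (alternate F ws) = alternate (\<lambda>v us. f (F v us)) ws"
  by (induction ws arbitrary: F) (simp_all add: linear_0[OF assms] linear_diff[OF assms])

lemma alternate_sum:
  "alternate (\<lambda>v us. \<Sum>i\<in>I. F i v us) ws = (\<Sum>i\<in>I. alternate (F i) ws)"
  by (induction ws arbitrary: F) (simp_all add: sum_subtractf)

lemma alternate_zero [simp]: "alternate (\<lambda>v us. 0) ws = 0"
  by (induction ws) simp_all

lemma linear_alternate_family:
  assumes "\<And>v us. linear (\<lambda>a. F a v us)"
  shows "linear (\<lambda>a. alternate (F a) ws)"
  using assms
proof (induction ws arbitrary: F)
  case (Cons w ws)
  show ?case
    using Cons.IH[of "\<lambda>a v us. F a v (w # us)"] Cons.prems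
    by (auto intro!: linear_compose_sub)
qed (simp add: linear_iff)

text \<open>
  If \<open>F v\<close> kills every list containing \<open>w\<close>, only the summand that moves \<open>w\<close> itself to the front survives.
\<close>

lemma alternate_single:
  assumes "\<And>v us. w \<in> set us \<Longrightarrow> F v us = 0"
  shows "alternate F (xs @ w # ys) = (-1) ^ length xs *\<^sub>R F w (xs @ ys)"
  using assms
proof (induction xs arbitrary: F)
  case Nil
  then show ?case by simp
next
  case (Cons x xs)
  then show ?case using Cons.IH[of "\<lambda>v us. F v (x # us)"] by simp
qed

text \<open>
  All three defining properties go by induction along the recursion. For a repeated argument the
  interesting case is that the head \<open>w\<close> occurs again in the tail: by \<open>alternate_single\<close> only two
  summands remain, and they cancel because moving \<open>w\<close> past the entries between the two occurrences
  costs exactly the sign in which the summands differ.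
\<close>

lemma alternate_alternating:
  assumes "\<And>v. F v \<in> alternating_maps k" "\<And>us. linear (\<lambda>v. F v us)"
  shows "alternate F \<in> alternating_maps (Suc k)"
proof (rule alternating_mapsI)
  have "alternate F ws = 0"
    if "\<And>v us. length us \<noteq> k \<Longrightarrow> F v us = 0" "length ws \<noteq> Suc k"
    for ws and F :: "'a \<Rightarrow> 'a list \<Rightarrow> 'b" and k
    using that
  proof (induction ws arbitrary: F k)
    case (Cons w ws)
    have "alternate (\<lambda>v us. F v (w # us)) ws = 0"
    proof (cases k)
      case 0
      then show ?thesis using Cons.prems by simp
    next
      case (Suc j)
      show ?thesis by (rule Cons.IH[of j]) (use Cons.prems Suc in auto)
    qed
    then show ?case using Cons.prems by simp
  qed simp
  then show "alternate F ws = 0" if "length ws \<noteq> Suc k" for ws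
    using that alternating_length[OF assms(1)] by blast
next
  have "linear (\<lambda>v. alternate F (xs @ v # ys))"
    if "\<And>v xs ys. linear (\<lambda>u. F v (xs @ u # ys))" "\<And>us. linear (\<lambda>v. F v us)" for F :: "'a \<Rightarrow> 'a list \<Rightarrow> 'b" and xs ys
    using that
  proof (induction xs arbitrary: F)
    case Nil
    have "linear (\<lambda>v. F u (v # us))" for u us
      using Nil(1)[of u "[]" us] by simp
    then show ?case using Nil
      by (auto intro!: linear_compose_sub linear_alternate_family)
  next
    case (Cons x xs)
    have "linear (\<lambda>v. alternate (\<lambda>v us. F v (x # us)) (xs @ v # ys))"
    proof (rule Cons.IH)
      show "linear (\<lambda>u. F v (x # xs @ u # ys))" for v xs ys
        using Cons.prems(1)[of v "x # xs" ys] by simp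
    qed (rule Cons.prems)
    then show ?case using Cons.prems
      by (auto intro!: linear_compose_sub)
  qed
  then show "linear (\<lambda>v. alternate F (xs @ v # ys))" for xs ys
    using alternating_linear[OF assms(1)] assms(2) by blast
next
  have "alternate F ws = 0"
    if "\<And>v. F v \<in> alternating_maps k" "\<not> distinct ws" for ws and F :: "'a \<Rightarrow> 'a list \<Rightarrow> 'b" and k
    using that
  proof (induction ws arbitrary: F k)
    case (Cons w ws)
    have d: "F v us = 0" if "\<not> distinct us" for v us
      using alternating_distinct[OF Cons.prems(1)] that by blast
    show ?case
    proof (cases "w \<in> set ws")
      case True
      then obtain xs ys where ws: "ws = xs @ w # ys" by (meson split_list)
      have "alternate (\<lambda>v us. F v (w # us)) ws = (-1) ^ length xs *\<^sub>R F w (w # xs @ ys)"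
        unfolding ws by (rule alternate_single) (simp add: d)
      then show ?thesis
        using alternating_move[OF Cons.prems(1)[of w], of xs w ys] by (simp add: ws)
    next
      case False
      then have nd: "\<not> distinct ws" using Cons.prems by simp
      have "contr w (F v) \<in> alternating_maps (k - 1)" for v
        using contr_alternating Cons.prems(1) by blast
      then have "alternate (\<lambda>v us. F v (w # us)) ws = 0"
        using Cons.IH[of "\<lambda>v us. F v (w # us)" "k - 1"] nd by (simp add: contr_def)
      then show ?thesis using nd d by simp
    qed
  qed simp
  then show "alternate F ws = 0" if "\<not> distinct ws" for ws
    using that assms(1) by blast
qed

text \<open>
  Each of the \<open>k\<close> summands is \<open>\<alpha> ws\<close>: the sign of the summand is the sign of putting the argument back
  in its place.
\<close>

lemma alternate_contr:
  assumes "\<alpha> \<in> alternating_maps k"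
  shows "alternate (\<lambda>v us. \<alpha> (v # us)) ws = real (length ws) *\<^sub>R \<alpha> ws"
  using assms
proof (induction ws arbitrary: \<alpha> k)
  case (Cons w ws)
  have swap: "\<alpha> (v # w # us) = - contr w \<alpha> (v # us)" for v us
    using alternating_swap[OF Cons.prems, of "[]" v w us] by (simp add: contr_def)
  have "alternate (\<lambda>v us. \<alpha> (v # w # us)) ws = alternate (\<lambda>v us. - contr w \<alpha> (v # us)) ws"
    by (simp only: swap)
  also have "\<dots> = - alternate (\<lambda>v us. contr w \<alpha> (v # us)) ws"
    using linear_alternate[of uminus "\<lambda>v us. contr w \<alpha> (v # us)" ws] by (simp add: linear_iff)
  also have "alternate (\<lambda>v us. contr w \<alpha> (v # us)) ws = real (length ws) *\<^sub>R contr w \<alpha> ws"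
    by (rule Cons.IH[OF contr_alternating[OF Cons.prems]])
  finally show ?case by (simp add: contr_def algebra_simps)
qed simp

section \<open>The trace contraction and the wedge with the identity\<close>

text \<open>
  The wedge of \<open>u\<close> with \<open>id\<^sub>V \<in> V\<^sup>* \<otimes> V\<close>, used to split the trace contraction.
\<close>

definition wedge_id :: "('v list \<Rightarrow> real) \<Rightarrow> 'v list \<Rightarrow> 'v::real_vector" where
  "wedge_id u = alternate (\<lambda>v us. u us *\<^sub>R v)"

text \<open>
  Up to the sign \<open>(-1)\<^bsup>k-1\<^esup>\<close> this is \<open>\<phi>\<^sub>k\<close>. Dropping the sign makes the map independent of the degree.
\<close>

definition trace_contr :: "('v::euclidean_space list \<Rightarrow> 'v) \<Rightarrow> 'v list \<Rightarrow> real" where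
  "trace_contr T = (\<lambda>ws. \<Sum>b\<in>Basis. T (b # ws) \<bullet> b)"

lemma phi_eq: "phi k T = (\<lambda>ws. (-1) ^ (k - 1) * trace_contr T ws)"
  by (simp add: phi_def trace_contr_def contr_def sum_distrib_left)

lemma K_ker_iff: "T \<in> K_ker k \<longleftrightarrow> T \<in> alternating_maps k \<and> trace_contr T = 0"
  by (auto simp: K_ker_def ext_power_tensor_def phi_eq fun_eq_iff)

lemma linear_inner_left: "linear (\<lambda>x. x \<bullet> b)"
  by (simp add: linear_iff inner_add_left)

lemma trace_contr_alternating:
  assumes "T \<in> alternating_maps k"
  shows "trace_contr T \<in> alternating_maps (k - 1)"
  unfolding trace_contr_def
proof (rule alternating_sum)
  show "(\<lambda>ws. T (b # ws) \<bullet> b) \<in> alternating_maps (k - 1)" for b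
    using alternating_maps_linear_comp[OF contr_alternating[OF assms, of b] linear_inner_left[of b]]
    by (simp add: contr_def)
qed

text \<open>
  The two contractions insert vectors into adjacent slots, so exchanging them costs a sign.
\<close>

lemma trace_contr_contr:
  assumes "T \<in> alternating_maps k"
  shows "trace_contr (contr v T) = - contr v (trace_contr T)"
proof
  fix ws
  have "T (v # b # ws) = - T (b # v # ws)" for b
    using alternating_swap[OF assms, of "[]" v b ws] by simp
  then show "trace_contr (contr v T) ws = (- contr v (trace_contr T)) ws"
    by (simp add: trace_contr_def contr_def sum_negf)
qed

lemma wedge_id_alternating:
  fixes u :: "'v::real_vector list \<Rightarrow> real"
  assumes "u \<in> alternating_maps k"
  shows "wedge_id u \<in> alternating_maps (Suc k)"
  unfolding wedge_id_def
proof (rule alternate_alternating)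
  show "(\<lambda>us. u us *\<^sub>R v) \<in> alternating_maps k" for v :: 'v
    using alternating_maps_linear_comp[OF assms, of "\<lambda>r. r *\<^sub>R v"] by (simp add: linear_iff algebra_simps)
qed (simp add: linear_iff algebra_simps)

text \<open>
  In \<open>\<iota>\<^sub>b(u \<and> id)\<close> the summand with \<open>b\<close> in the vector slot contributes \<open>u\<close> for each of the \<open>n\<close> basis vectors,
  and the others reassemble, with the opposite sign, to the \<open>k\<close> copies of \<open>u\<close> counted by \<open>alternate_contr\<close>. Hence
  the trace contraction is onto in degrees \<open>k < n\<close>.
\<close>

lemma trace_contr_wedge_id:
  fixes u :: "'v::euclidean_space list \<Rightarrow> real"
  assumes u: "u \<in> alternating_maps k"
  shows "trace_contr (wedge_id u) ws = (real DIM('v) - real k) * u ws"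
proof -
  have "wedge_id u (b # ws) \<bullet> b = u ws - alternate (\<lambda>v us. (v \<bullet> b) *\<^sub>R u (b # us)) ws"
    if "b \<in> Basis" for b
    using that linear_alternate[OF linear_inner_left[of b], of "\<lambda>v us. u (b # us) *\<^sub>R v" ws]
    by (simp add: wedge_id_def inner_diff_left mult.commute)
  then have "trace_contr (wedge_id u) ws =
      real DIM('v) * u ws - alternate (\<lambda>v us. \<Sum>b\<in>Basis. (v \<bullet> b) *\<^sub>R u (b # us)) ws"
    by (simp add: trace_contr_def sum_subtractf alternate_sum)
  also have "(\<lambda>v us. \<Sum>b\<in>Basis. (v \<bullet> b) *\<^sub>R u (b # us)) = (\<lambda>v us. u (v # us))"
    using alternating_expand[OF u, of "[]", symmetric] by simp
  also have "alternate (\<lambda>v us. u (v # us)) ws = real k * u ws"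
    using alternate_contr[OF u] alternating_length[OF u] by (cases "length ws = k") auto
  finally show ?thesis by (simp add: algebra_simps)
qed

text \<open>
  For a top degree form \<open>u\<close> the form \<open>u \<and> id\<close> has degree \<open>n + 1\<close> and vanishes; inserting \<open>b\<close> as first
  argument expresses \<open>u \<otimes> b\<close> through the remaining summands. Applied to the components \<open>u = T \<bullet> b\<close> and
  summed over \<open>b\<close>, this recovers \<open>T\<close> from its trace.
\<close>

lemma wedge_id_trace_contr:
  fixes T :: "'v::euclidean_space list \<Rightarrow> 'v"
  assumes T: "T \<in> alternating_maps DIM('v)"
  shows "wedge_id (trace_contr T) = T"
proof
  fix ws
  have b: "alternate (\<lambda>v us. (T (b # us) \<bullet> b) *\<^sub>R v) ws = (T ws \<bullet> b) *\<^sub>R b" for b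
  proof -
    have "(\<lambda>us. T us \<bullet> b) \<in> alternating_maps DIM('v)"
      by (rule alternating_maps_linear_comp[OF T linear_inner_left])
    from wedge_id_alternating[OF this]
    have "wedge_id (\<lambda>us. T us \<bullet> b) (b # ws) = 0"
      by (rule alternating_vanish_above_dim) simp
    then show ?thesis by (simp add: wedge_id_def)
  qed
  show "wedge_id (trace_contr T) ws = T ws"
    by (simp add: wedge_id_def trace_contr_def scaleR_sum_left alternate_sum b euclidean_representation)
qed

section \<open>Smooth functions\<close>

lemma times_differentiable_lower:
  "times_differentiable (Suc m) f \<Longrightarrow> times_differentiable m f"
proof (induction m arbitrary: f)
  case 0
  then show ?case
    by (simp add: differentiable_imp_continuous_within continuous_at_imp_continuous_on)
next
  case (Suc m)
  then show ?case by (metis times_differentiable.simps(2))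
qed

lemma times_differentiable_continuous:
  "times_differentiable m f \<Longrightarrow> continuous_on UNIV f"
  by (induction m) (auto dest: times_differentiable_lower simp del: times_differentiable.simps(2))

lemma smooth_differentiable: "smooth f \<Longrightarrow> f differentiable at x"
  unfolding smooth_def by (metis times_differentiable.simps(2))

lemma smooth_continuous: "smooth f \<Longrightarrow> continuous_on UNIV f"
  unfolding smooth_def using times_differentiable_continuous by blast

lemma smooth_directional: "smooth f \<Longrightarrow> smooth (\<lambda>x. frechet_derivative f (at x) v)"
  unfolding smooth_def by (metis times_differentiable.simps(2))

lemma smooth_has_derivative:
  "smooth f \<Longrightarrow> (f has_derivative frechet_derivative f (at x)) (at x)"
  using smooth_differentiable frechet_derivative_works by blast

text \<open>
  Derivatives are unique, so the directional derivatives may be checked on any given derivative.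
\<close>

lemma times_differentiable_SucI:
  assumes "\<And>x. (f has_derivative f' x) (at x)"
    and "\<And>v. times_differentiable m (\<lambda>x. f' x v)"
  shows "times_differentiable (Suc m) f"
proof -
  have "frechet_derivative f (at x) = f' x" for x
    using frechet_derivative_at[OF assms(1)] by simp
  then show ?thesis using assms by (auto simp: differentiable_def)
qed

lemma times_differentiable_derivative:
  assumes "times_differentiable (Suc m) f"
  shows "(f has_derivative frechet_derivative f (at x)) (at x)"
    and "times_differentiable m (\<lambda>x. frechet_derivative f (at x) v)"
  using assms frechet_derivative_works by auto

lemma times_differentiable_const: "times_differentiable m (\<lambda>x. c)"
proof (induction m arbitrary: c)
  case (Suc m)
  show ?case by (rule times_differentiable_SucI[OF has_derivative_const Suc])
qed simp

lemma times_differentiable_add: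
  "times_differentiable m f \<Longrightarrow> times_differentiable m g \<Longrightarrow> times_differentiable m (\<lambda>x. f x + g x)"
proof (induction m arbitrary: f g)
  case (Suc m)
  show ?case
    by (rule times_differentiable_SucI[OF has_derivative_add[OF
          times_differentiable_derivative(1)[OF Suc.prems(1)] times_differentiable_derivative(1)[OF Suc.prems(2)]]])
       (intro Suc.IH times_differentiable_derivative(2) Suc.prems)
qed (simp add: continuous_on_add)

lemma times_differentiable_linear:
  assumes "bounded_linear h"
  shows "times_differentiable m f \<Longrightarrow> times_differentiable m (\<lambda>x. h (f x))"
proof (induction m arbitrary: f)
  case 0
  then show ?case using bounded_linear.continuous_on[OF assms] by simp
next
  case (Suc m)
  show ?case
    by (rule times_differentiable_SucI[OF bounded_linear.has_derivative[OF assms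
          times_differentiable_derivative(1)[OF Suc.prems]]])
       (intro Suc.IH times_differentiable_derivative(2) Suc.prems)
qed

lemma times_differentiable_coordinate:
  fixes f :: "'v::real_inner \<Rightarrow> 'b::real_normed_vector"
  shows "times_differentiable m f \<Longrightarrow> times_differentiable m (\<lambda>x. (x \<bullet> b) *\<^sub>R f x)"
proof (induction m arbitrary: f)
  case 0
  then show ?case by (auto intro!: continuous_intros)
next
  case (Suc m)
  note d = times_differentiable_derivative[OF Suc.prems]
  have "((\<lambda>x. (x \<bullet> b) *\<^sub>R f x) has_derivative
      (\<lambda>v. (x \<bullet> b) *\<^sub>R frechet_derivative f (at x) v + (v \<bullet> b) *\<^sub>R f x)) (at x)" for x
    by (intro has_derivative_scaleR has_derivative_inner_left has_derivative_ident d)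
  then show ?case
  proof (rule times_differentiable_SucI)
    show "times_differentiable m
        (\<lambda>x. (x \<bullet> b) *\<^sub>R frechet_derivative f (at x) v + (v \<bullet> b) *\<^sub>R f x)" for v
      by (intro times_differentiable_add Suc.IH d times_differentiable_lower[OF Suc.prems]
          times_differentiable_linear[OF bounded_linear_scaleR_right])
  qed
qed

lemma smooth_const: "smooth (\<lambda>x. c)"
  by (simp add: smooth_def times_differentiable_const)

lemma smooth_add: "smooth f \<Longrightarrow> smooth g \<Longrightarrow> smooth (\<lambda>x. f x + g x)"
  by (simp add: smooth_def times_differentiable_add)

lemma smooth_linear: "bounded_linear h \<Longrightarrow> smooth f \<Longrightarrow> smooth (\<lambda>x. h (f x))"
  by (simp add: smooth_def times_differentiable_linear)

lemma smooth_minus: "smooth f \<Longrightarrow> smooth (\<lambda>x. - f x)"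
  using smooth_linear[OF bounded_linear_minus[OF bounded_linear_ident]] .

lemma smooth_diff: "smooth f \<Longrightarrow> smooth g \<Longrightarrow> smooth (\<lambda>x. f x - g x)"
  using smooth_add[of f "\<lambda>x. - g x"] smooth_minus by fastforce

lemma smooth_sum: "(\<And>i. i \<in> I \<Longrightarrow> smooth (f i)) \<Longrightarrow> smooth (\<lambda>x. \<Sum>i\<in>I. f i x)"
  by (induction I rule: infinite_finite_induct) (auto intro: smooth_const smooth_add)

lemma smooth_coordinate:
  fixes f :: "'v::real_inner \<Rightarrow> 'b::real_normed_vector"
  shows "smooth f \<Longrightarrow> smooth (\<lambda>x. (x \<bullet> b) *\<^sub>R f x)"
  by (simp add: smooth_def times_differentiable_coordinate)

lemma smooth_alternate:
  "(\<And>v us. smooth (\<lambda>x. F x v us)) \<Longrightarrow> smooth (\<lambda>x. alternate (F x) ws)"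
proof (induction ws arbitrary: F)
  case (Cons w ws)
  have "smooth (\<lambda>x. alternate (\<lambda>v us. F x v (w # us)) ws)"
    by (rule Cons.IH) (rule Cons.prems)
  then show ?case by (simp add: smooth_diff Cons.prems)
qed (simp add: smooth_const)

section \<open>Averages along rays\<close>

text \<open>
  The operator inverting the Lie derivative along the Euler vector field \<open>x \<mapsto> x\<close>: on the coefficients of
  forms of degree \<open>k\<close> that derivative is \<open>f \<mapsto> Df(x)x + k f\<close>, with inverse \<open>radial_average (k - 1)\<close>; see
  \<open>radial_average_euler\<close>.
\<close>

definition radial_average :: "nat \<Rightarrow> ('v::real_vector \<Rightarrow> 'b::euclidean_space) \<Rightarrow> 'v \<Rightarrow> 'b" where
  "radial_average k f x = integral {0..1} (\<lambda>t. t ^ k *\<^sub>R f (t *\<^sub>R x))"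

lemma radial_integrable:
  fixes f :: "'v::real_normed_vector \<Rightarrow> 'b::euclidean_space"
  assumes "continuous_on UNIV f"
  shows "(\<lambda>t. t ^ k *\<^sub>R f (t *\<^sub>R x)) integrable_on {0..1::real}"
  by (intro integrable_continuous_real continuous_intros continuous_on_compose2[OF assms]) auto

lemma radial_continuous:
  fixes f :: "'v::real_normed_vector \<Rightarrow> 'b::euclidean_space"
  assumes "continuous_on UNIV f"
  shows "continuous_on (UNIV \<times> cbox 0 1) (\<lambda>(x, t::real). t ^ k *\<^sub>R f (t *\<^sub>R x))"
  unfolding split_beta
  by (intro continuous_intros continuous_on_compose2[OF assms]) auto

text \<open>
  Differentiation under the integral sign; the chain rule for \<open>x \<mapsto> t x\<close> supplies the additional factor \<open>t\<close>.
\<close>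

lemma radial_average_has_derivative:
  fixes f :: "'v::euclidean_space \<Rightarrow> 'b::euclidean_space"
  assumes f: "times_differentiable (Suc 0) f"
  shows "(radial_average k f has_derivative
      (\<lambda>v. radial_average (Suc k) (\<lambda>x. frechet_derivative f (at x) v) x)) (at x)"
proof -
  define D where "D x t = Blinfun (\<lambda>v. t ^ Suc k *\<^sub>R frechet_derivative f (at (t *\<^sub>R x)) v)"
    for x and t :: real
  have bl: "bounded_linear (\<lambda>v. t ^ Suc k *\<^sub>R frechet_derivative f (at (t *\<^sub>R x)) v)" for x t
    using times_differentiable_derivative(1)[OF f]
    by (intro bounded_linear_const_scaleR has_derivative_bounded_linear)
  have D: "blinfun_apply (D x t) v = t ^ Suc k *\<^sub>R frechet_derivative f (at (t *\<^sub>R x)) v" for x t v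
    unfolding D_def using bl by (simp add: bounded_linear_Blinfun_apply)
  have c: "continuous_on UNIV (\<lambda>x. frechet_derivative f (at x) v)" for v
    using times_differentiable_derivative(2)[OF f] by simp
  have cD: "continuous_on (UNIV \<times> cbox 0 1) (\<lambda>(x, t). D x t)"
    using radial_continuous[OF c, of "Suc k"]
    by (intro continuous_on_blinfun_componentwise) (simp add: split_beta D)
  have "((\<lambda>x. t ^ k *\<^sub>R f (t *\<^sub>R x)) has_derivative blinfun_apply (D x t)) (at x)" for x t
  proof -
    have "((\<lambda>x. f (t *\<^sub>R x)) has_derivative
        (\<lambda>v. frechet_derivative f (at (t *\<^sub>R x)) (t *\<^sub>R v))) (at x)"
      by (rule has_derivative_compose[of "\<lambda>x. t *\<^sub>R x"])
         (auto intro!: derivative_eq_intros times_differentiable_derivative(1)[OF f])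
    moreover have "frechet_derivative f (at (t *\<^sub>R x)) (t *\<^sub>R v) = t *\<^sub>R frechet_derivative f (at (t *\<^sub>R x)) v" for v
      using has_derivative_linear[OF times_differentiable_derivative(1)[OF f]] by (simp add: linear_scale)
    ultimately show ?thesis
      by (auto intro!: derivative_eq_intros simp: D fun_eq_iff)
  qed
  then have "((\<lambda>x. integral (cbox 0 1) (\<lambda>t. t ^ k *\<^sub>R f (t *\<^sub>R x))) has_derivative
      blinfun_apply (integral (cbox 0 1) (D x))) (at x within UNIV)"
    using radial_integrable[OF times_differentiable_continuous[OF f]]
    by (intro leibniz_rule cD) (auto simp: cbox_interval)
  moreover have "blinfun_apply (integral (cbox 0 1) (D x)) v =
      radial_average (Suc k) (\<lambda>x. frechet_derivative f (at x) v) x" for v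
  proof -
    have "continuous_on (cbox 0 1) (D x)"
      using continuous_on_compose2[OF cD, of "cbox 0 1" "Pair x"]
      by (auto simp: continuous_on_Pair simp del: cbox_interval)
    then have "D x integrable_on cbox 0 1"
      by (rule integrable_continuous)
    then show ?thesis
      by (simp only: blinfun_apply_integral D radial_average_def cbox_interval)
  qed
  ultimately show ?thesis
    by (metis (no_types, lifting) ext cbox_interval radial_average_def)
qed

text \<open>
  The exponent is generalized in the induction since it increases with each derivative.
\<close>

lemma times_differentiable_radial_average:
  fixes f :: "'v::euclidean_space \<Rightarrow> 'b::euclidean_space"
  shows "times_differentiable m f \<Longrightarrow> times_differentiable m (radial_average k f)"
proof (induction m arbitrary: f k)
  case 0
  then show ?case
    using integral_continuous_on_param[OF radial_continuous[of f k]]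
    by (simp add: radial_average_def[abs_def] cbox_interval)
next
  case (Suc m)
  have "times_differentiable (Suc 0) f"
    using Suc.prems times_differentiable_continuous by auto
  then show ?case
    by (intro times_differentiable_SucI[OF radial_average_has_derivative] Suc.IH
        times_differentiable_derivative(2) Suc.prems)
qed

lemma smooth_radial_average:
  fixes f :: "'v::euclidean_space \<Rightarrow> 'b::euclidean_space"
  shows "smooth f \<Longrightarrow> smooth (radial_average k f)"
  by (simp add: smooth_def times_differentiable_radial_average)

section \<open>Exactness of the smooth Koszul complex\<close>

lemma sectionsI:
  "(\<And>x. s x \<in> U) \<Longrightarrow> (\<And>ws. smooth (\<lambda>x. s x ws)) \<Longrightarrow> s \<in> \<Gamma> U"
  by (simp add: sections_def)

lemma sectionsD:
  assumes "s \<in> \<Gamma> U"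
  shows "s x \<in> U" "smooth (\<lambda>x. s x ws)"
  using assms by (simp_all add: sections_def)

text \<open>
  Contraction with the Euler vector field \<open>x \<mapsto> x\<close>. Up to sign, \<open>d_map\<close> and \<open>bdry\<close> are this map;
  so is \<open>rho\<close>, when \<open>0\<close>-forms with values in \<open>V\<close> are read as vector fields.
\<close>

definition euler_contr :: "('v \<Rightarrow> 'v list \<Rightarrow> 'b) \<Rightarrow> 'v \<Rightarrow> 'v list \<Rightarrow> 'b" where
  "euler_contr s = (\<lambda>x. contr x (s x))"

lemma euler_contr_expand:
  fixes s :: "'v::euclidean_space \<Rightarrow> 'v list \<Rightarrow> 'b::real_normed_vector"
  assumes "s \<in> \<Gamma> (alternating_maps k)"
  shows "euler_contr s x ws = (\<Sum>b\<in>Basis. (x \<bullet> b) *\<^sub>R s x (b # ws))"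
  using alternating_expand[OF sectionsD(1)[OF assms], of x "[]" x ws, symmetric]
  by (simp add: euler_contr_def contr_def)

lemma euler_contr_sections:
  fixes s :: "'v::euclidean_space \<Rightarrow> 'v list \<Rightarrow> 'b::real_normed_vector"
  assumes "s \<in> \<Gamma> (alternating_maps k)"
  shows "euler_contr s \<in> \<Gamma> (alternating_maps (k - 1))"
proof (rule sectionsI)
  show "euler_contr s x \<in> alternating_maps (k - 1)" for x
    unfolding euler_contr_def by (rule contr_alternating[OF sectionsD(1)[OF assms]])
  show "smooth (\<lambda>x. euler_contr s x ws)" for ws
    unfolding euler_contr_expand[OF assms]
    by (intro smooth_sum smooth_coordinate sectionsD(2)[OF assms])
qed

lemma euler_contr_euler_contr:
  assumes "s \<in> \<Gamma> (alternating_maps k)"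
  shows "euler_contr (euler_contr s) = 0"
  using contr_contr[OF sectionsD(1)[OF assms]] by (simp add: euler_contr_def fun_eq_iff)

lemma derivative_alternating:
  fixes s :: "'v::euclidean_space \<Rightarrow> 'v list \<Rightarrow> 'b::euclidean_space"
  assumes s: "s \<in> \<Gamma> (alternating_maps k)"
  shows "(\<lambda>ws. frechet_derivative (\<lambda>x. s x ws) (at y) v) \<in> alternating_maps k"
proof (rule alternating_mapsI)
  note D = smooth_has_derivative[OF sectionsD(2)[OF s]]
  have zero: "frechet_derivative (\<lambda>x. s x ws) (at y) v = 0" if "\<And>x. s x ws = 0" for ws
    using that by simp
  show "frechet_derivative (\<lambda>x. s x ws) (at y) v = 0" if "length ws \<noteq> k" for ws
    using alternating_length[OF sectionsD(1)[OF s] that] by (rule zero)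
  show "frechet_derivative (\<lambda>x. s x ws) (at y) v = 0" if "\<not> distinct ws" for ws
    using alternating_distinct[OF sectionsD(1)[OF s] that] by (rule zero)
  fix xs ys
  note l = alternating_linear[OF sectionsD(1)[OF s], of _ xs ys]
  show "linear (\<lambda>u. frechet_derivative (\<lambda>x. s x (xs @ u # ys)) (at y) v)"
  proof (rule linearI)
    fix a b :: 'v and c :: real
    have "((\<lambda>x. s x (xs @ (a + b) # ys)) has_derivative
        (\<lambda>v. frechet_derivative (\<lambda>x. s x (xs @ a # ys)) (at y) v
           + frechet_derivative (\<lambda>x. s x (xs @ b # ys)) (at y) v)) (at y)"
      unfolding linear_add[OF l] by (intro has_derivative_add D)
    from frechet_derivative_at[OF this]
    show "frechet_derivative (\<lambda>x. s x (xs @ (a + b) # ys)) (at y) v =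
        frechet_derivative (\<lambda>x. s x (xs @ a # ys)) (at y) v
           + frechet_derivative (\<lambda>x. s x (xs @ b # ys)) (at y) v"
      by metis
    have "((\<lambda>x. s x (xs @ (c *\<^sub>R a) # ys)) has_derivative
        (\<lambda>v. c *\<^sub>R frechet_derivative (\<lambda>x. s x (xs @ a # ys)) (at y) v)) (at y)"
      unfolding linear_scale[OF l] by (intro has_derivative_scaleR_right D)
    from frechet_derivative_at[OF this]
    show "frechet_derivative (\<lambda>x. s x (xs @ (c *\<^sub>R a) # ys)) (at y) v =
        c *\<^sub>R frechet_derivative (\<lambda>x. s x (xs @ a # ys)) (at y) v"
      by metis
  qed
qed

lemma radial_average_add:
  fixes f g :: "'v::real_normed_vector \<Rightarrow> 'b::euclidean_space"
  assumes "continuous_on UNIV f" "continuous_on UNIV g"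
  shows "radial_average k (\<lambda>x. f x + g x) x = radial_average k f x + radial_average k g x"
  unfolding radial_average_def scaleR_add_right
  by (intro integral_add radial_integrable assms)

lemma radial_average_scale:
  "radial_average k (\<lambda>x. c *\<^sub>R f x) x = c *\<^sub>R radial_average k f x"
proof -
  have "(\<lambda>t. t ^ k *\<^sub>R c *\<^sub>R f (t *\<^sub>R x)) = (\<lambda>t. c *\<^sub>R t ^ k *\<^sub>R f (t *\<^sub>R x))"
    by (simp add: mult.commute)
  then show ?thesis by (simp only: radial_average_def integral_cmul)
qed

lemma radial_average_alternating:
  fixes s :: "'v::euclidean_space \<Rightarrow> 'v list \<Rightarrow> 'b::euclidean_space"
  assumes s: "\<And>y. s y \<in> alternating_maps k" and c: "\<And>ws. continuous_on UNIV (\<lambda>y. s y ws)"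
  shows "(\<lambda>ws. radial_average j (\<lambda>y. s y ws) x) \<in> alternating_maps k"
proof (rule alternating_mapsI)
  show "radial_average j (\<lambda>y. s y ws) x = 0" if "length ws \<noteq> k" for ws
    using alternating_length[OF s that] by (simp add: radial_average_def)
  show "radial_average j (\<lambda>y. s y ws) x = 0" if "\<not> distinct ws" for ws
    using alternating_distinct[OF s that] by (simp add: radial_average_def)
  fix xs ys
  note l = alternating_linear[OF s, of _ xs ys]
  show "linear (\<lambda>u. radial_average j (\<lambda>y. s y (xs @ u # ys)) x)"
    by (intro linearI) (simp_all only: linear_add[OF l] linear_scale[OF l]
        radial_average_add[OF c c] radial_average_scale)
qed

text \<open>
  The two integrands add up to the derivative of \<open>t \<mapsto> t\<^sup>k f(t x)\<close>, a function that is \<open>f(x)\<close> at \<open>t = 1\<close> and,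
  because of \<open>k > 0\<close>, vanishes at \<open>t = 0\<close>.
\<close>

lemma radial_average_euler:
  fixes f :: "'v::euclidean_space \<Rightarrow> 'b::euclidean_space"
  assumes "smooth f" "k > 0"
  shows "radial_average k (\<lambda>y. frechet_derivative f (at y) x) x + real k *\<^sub>R radial_average (k - 1) f x = f x"
proof -
  let ?Df = "\<lambda>y. frechet_derivative f (at y)"
  have "((\<lambda>t. t ^ k *\<^sub>R f (t *\<^sub>R x)) has_vector_derivative
      t ^ k *\<^sub>R ?Df (t *\<^sub>R x) x + real k *\<^sub>R t ^ (k - 1) *\<^sub>R f (t *\<^sub>R x)) (at t within {0..1})" for t
  proof -
    have "((\<lambda>t. f (t *\<^sub>R x)) has_derivative (\<lambda>h. ?Df (t *\<^sub>R x) (h *\<^sub>R x))) (at t within {0..1})"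
      by (rule has_derivative_compose[of "\<lambda>t. t *\<^sub>R x"])
         (auto intro!: derivative_eq_intros smooth_has_derivative[OF assms(1)])
    then have "((\<lambda>t. f (t *\<^sub>R x)) has_vector_derivative ?Df (t *\<^sub>R x) x) (at t within {0..1})"
      using has_derivative_linear[OF smooth_has_derivative[OF assms(1)]]
      by (simp add: has_vector_derivative_def linear_scale)
    moreover have "((\<lambda>t. t ^ k) has_field_derivative real k * t ^ (k - 1)) (at t within {0..1})"
      by (auto intro!: derivative_eq_intros)
    ultimately show ?thesis
      using has_vector_derivative_scaleR by fastforce
  qed
  then have "((\<lambda>t. t ^ k *\<^sub>R ?Df (t *\<^sub>R x) x + real k *\<^sub>R t ^ (k - 1) *\<^sub>R f (t *\<^sub>R x)) has_integral
      (1 ^ k *\<^sub>R f (1 *\<^sub>R x) - 0 ^ k *\<^sub>R f (0 *\<^sub>R x))) {0..1}"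
    by (intro fundamental_theorem_of_calculus) auto
  moreover have "(\<lambda>t. t ^ k *\<^sub>R ?Df (t *\<^sub>R x) x) integrable_on {0..1}"
    "(\<lambda>t. t ^ (k - 1) *\<^sub>R f (t *\<^sub>R x)) integrable_on {0..1}"
    by (intro radial_integrable smooth_continuous smooth_directional assms)+
  ultimately have "integral {0..1} (\<lambda>t. t ^ k *\<^sub>R ?Df (t *\<^sub>R x) x)
      + integral {0..1} (\<lambda>t. real k *\<^sub>R t ^ (k - 1) *\<^sub>R f (t *\<^sub>R x)) = f x"
    using \<open>k > 0\<close> by (subst integral_add[symmetric])
      (auto dest: integral_unique intro!: integrable_cmul simp del: scaleR_scaleR)
  then show ?thesis
    unfolding radial_average_def integral_cmul .
qed

text \<open>
  Cartan's formula \<open>L\<^sub>E = d \<iota>\<^sub>E + \<iota>\<^sub>E d\<close> for the Euler field \<open>E\<close>: if \<open>\<iota>\<^sub>E s = 0\<close>, then \<open>s' = L\<^sub>E\<^sup>-\<^sup>1 s\<close> is also killed by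
  \<open>\<iota>\<^sub>E\<close>, so \<open>s = L\<^sub>E s' = \<iota>\<^sub>E (d s')\<close>. In positive degree \<open>L\<^sub>E\<close> is invertible on smooth forms by averaging
  along rays. The witness is \<open>d s'\<close> written out, with the derivative moved under the integral.
\<close>

lemma koszul_exact:
  fixes s :: "'v::euclidean_space \<Rightarrow> 'v list \<Rightarrow> 'b::euclidean_space"
  assumes s: "s \<in> \<Gamma> (alternating_maps k)" and "k > 0" and ker: "euler_contr s = 0"
  shows "\<exists>t \<in> \<Gamma> (alternating_maps (Suc k)). euler_contr t = s"
proof
  define D where "D us y = frechet_derivative (\<lambda>x. s x us) (at y)" for us y
  define F where "F x v us = radial_average k (\<lambda>y. D us y v) x" for x v us
  define A where "A x us = radial_average (k - 1) (\<lambda>y. s y us) x" for x us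
  let ?t = "\<lambda>x. alternate (F x)"
  have D: "((\<lambda>x. s x us) has_derivative D us y) (at y)" for us y
    unfolding D_def by (rule smooth_has_derivative[OF sectionsD(2)[OF s]])
  have linD: "linear (D us y)" for us y
    using has_derivative_linear[OF D] .
  have smD: "smooth (\<lambda>y. D us y v)" for us v
    unfolding D_def by (rule smooth_directional[OF sectionsD(2)[OF s]])
  show "?t \<in> \<Gamma> (alternating_maps (Suc k))"
  proof (rule sectionsI)
    show "smooth (\<lambda>x. alternate (F x) ws)" for ws
      unfolding F_def by (intro smooth_alternate smooth_radial_average smD)
    show "alternate (F x) \<in> alternating_maps (Suc k)" for x
    proof (rule alternate_alternating)
      show "F x v \<in> alternating_maps k" for v
        unfolding F_def using derivative_alternating[OF s] smooth_continuous[OF smD]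
        by (intro radial_average_alternating) (simp_all add: D_def)
      show "linear (\<lambda>v. F x v us)" for us
        unfolding F_def
        by (intro linearI) (simp_all only: linear_add[OF linD] linear_scale[OF linD]
            radial_average_add[OF smooth_continuous[OF smD] smooth_continuous[OF smD]] radial_average_scale)
    qed
  qed
  have A: "A x \<in> alternating_maps k" for x
    unfolding A_def
    by (intro radial_average_alternating sectionsD(1)[OF s] smooth_continuous sectionsD(2)[OF s])
  \<comment> \<open>Differentiating the identity \<open>s y (y # us) = 0\<close> in \<open>y\<close>, in direction \<open>v\<close>.\<close>
  have leibniz: "s y (v # us) + D (y # us) y v = 0" for y v us
  proof -
    have "((\<lambda>x. euler_contr s x us) has_derivative
        (\<lambda>v. \<Sum>b\<in>Basis. (y \<bullet> b) *\<^sub>R D (b # us) y v + (v \<bullet> b) *\<^sub>R s y (b # us))) (at y)"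
      unfolding euler_contr_expand[OF s]
      by (intro has_derivative_sum has_derivative_scaleR has_derivative_inner_left has_derivative_ident D)
    moreover have "((\<lambda>x. euler_contr s x us) has_derivative (\<lambda>v. 0)) (at y)"
      by (simp add: ker)
    ultimately have "(\<lambda>v. \<Sum>b\<in>Basis. (y \<bullet> b) *\<^sub>R D (b # us) y v + (v \<bullet> b) *\<^sub>R s y (b # us)) = (\<lambda>v. 0)"
      by (rule has_derivative_unique)
    then have "(\<Sum>b\<in>Basis. (y \<bullet> b) *\<^sub>R D (b # us) y v + (v \<bullet> b) *\<^sub>R s y (b # us)) = 0"
      by (rule fun_cong)
    moreover have "(\<Sum>b\<in>Basis. (v \<bullet> b) *\<^sub>R s y (b # us)) = s y (v # us)"
      using alternating_expand[OF sectionsD(1)[OF s], of y "[]" v us, symmetric] by simp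
    moreover have "(\<Sum>b\<in>Basis. (y \<bullet> b) *\<^sub>R D (b # us) y v) = D (y # us) y v"
      using alternating_expand[OF derivative_alternating[OF s, of y v], of "[]" y us, symmetric]
      by (simp add: D_def)
    ultimately show ?thesis
      by (simp add: sum.distrib add.commute)
  qed
  \<comment> \<open>The previous identity at \<open>y = t x\<close> trades one factor \<open>t\<close> for the derivative, which shows that
    \<open>d\<close> and \<open>\<iota>\<^sub>E\<close> combine to the constant part \<open>k\<close> of the Lie derivative.\<close>
  have F_A: "F x v (x # us) = - A x (v # us)" for x v us
  proof -
    have "t ^ k *\<^sub>R D (x # us) (t *\<^sub>R x) v = - (t ^ (k - 1) *\<^sub>R s (t *\<^sub>R x) (v # us))" for t
    proof -
      have "D ((t *\<^sub>R x) # us) (t *\<^sub>R x) v = t *\<^sub>R D (x # us) (t *\<^sub>R x) v"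
        using linear_scale[OF alternating_linear_hd[OF derivative_alternating[OF s]]] by (simp add: D_def)
      then have "t *\<^sub>R D (x # us) (t *\<^sub>R x) v = - s (t *\<^sub>R x) (v # us)"
        using leibniz[of "t *\<^sub>R x" v us] by (simp add: eq_neg_iff_add_eq_0 add.commute)
      moreover have "t ^ k *\<^sub>R D (x # us) (t *\<^sub>R x) v = t ^ (k - 1) *\<^sub>R t *\<^sub>R D (x # us) (t *\<^sub>R x) v"
        using \<open>k > 0\<close> by (cases k) simp_all
      ultimately show ?thesis by simp
    qed
    then show ?thesis by (simp add: F_def A_def radial_average_def)
  qed
  have "euler_contr ?t x ws = s x ws" for x ws
  proof (cases "length ws = k")
    case True
    have "alternate (\<lambda>v us. F x v (x # us)) ws = - alternate (\<lambda>v us. A x (v # us)) ws"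
      unfolding F_A by (rule linear_alternate[symmetric]) (simp add: linear_iff)
    also have "alternate (\<lambda>v us. A x (v # us)) ws = real k *\<^sub>R A x ws"
      by (simp add: alternate_contr[OF A] True)
    finally have "euler_contr ?t x ws = F x x ws + real k *\<^sub>R A x ws"
      by (simp add: euler_contr_def contr_def)
    also have "\<dots> = s x ws"
      unfolding F_def A_def D_def by (rule radial_average_euler[OF sectionsD(2)[OF s] \<open>k > 0\<close>])
    finally show ?thesis .
  next
    case False
    have "euler_contr ?t \<in> \<Gamma> (alternating_maps k)"
      using euler_contr_sections[OF \<open>?t \<in> \<Gamma> (alternating_maps (Suc k))\<close>] by simp
    then show ?thesis
      using alternating_length[OF sectionsD(1) False] alternating_length[OF sectionsD(1)[OF s] False] by metis
  qed
  then show "euler_contr ?t = s" by blast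
qed

text \<open>
  The primitive given by exactness has degree \<open>n + 1\<close>, so it vanishes. This avoids dividing by \<open>x\<close> off the origin.
\<close>

lemma koszul_exact_top:
  fixes s :: "'v::euclidean_space \<Rightarrow> 'v list \<Rightarrow> 'b::euclidean_space"
  assumes s: "s \<in> \<Gamma> (alternating_maps DIM('v))" and ker: "euler_contr s = 0"
  shows "s = 0"
proof -
  obtain t where t: "t \<in> \<Gamma> (alternating_maps (Suc DIM('v)))" "euler_contr t = s"
    using koszul_exact[OF s DIM_positive ker] by blast
  have "t x ws = 0" for x ws
    by (rule alternating_vanish_above_dim[OF sectionsD(1)[OF t(1)]]) simp
  then show ?thesis using t(2) by (auto simp: euler_contr_def contr_def fun_eq_iff)
qed

section \<open>The complex of the kernels\<close>

lemma d_map_eq_euler_contr: "s \<in> \<Gamma> (alternating_maps k) \<Longrightarrow> d_map s = euler_contr s"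
  by (simp add: d_map_def fun_eq_iff euler_contr_expand contr_def)

lemma bdry_eq_euler_contr: "s \<in> \<Gamma> (alternating_maps k) \<Longrightarrow> bdry s = - euler_contr s"
  by (simp add: bdry_def fun_eq_iff euler_contr_expand contr_def)

lemma rho_eq_euler_contr: "s \<in> \<Gamma> (alternating_maps k) \<Longrightarrow> rho s x = euler_contr s x []"
  by (simp add: rho_def euler_contr_expand)

text \<open>
  A \<open>0\<close>-form with values in \<open>V\<close> is determined by its value on the empty list.
\<close>

lemma rho_eq_0_iff:
  assumes "s \<in> \<Gamma> (alternating_maps 1)"
  shows "rho s = 0 \<longleftrightarrow> euler_contr s = 0"
proof
  assume "rho s = 0"
  then have "euler_contr s x ws = 0" for x ws
    using rho_eq_euler_contr[OF assms, of x]
      alternating_length[OF sectionsD(1)[OF euler_contr_sections[OF assms]], of ws x]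
    by (cases ws) auto
  then show "euler_contr s = 0" by (simp add: fun_eq_iff)
qed (simp add: rho_eq_euler_contr[OF assms] fun_eq_iff)

definition trace_sec where "trace_sec s = (\<lambda>x. trace_contr (s x))"
definition wedge_sec where "wedge_sec s = (\<lambda>x. wedge_id (s x))"

lemma sections_K_ker:
  "s \<in> \<Gamma> (K_ker k) \<longleftrightarrow> s \<in> \<Gamma> (alternating_maps k) \<and> trace_sec s = 0"
  by (auto simp: sections_def K_ker_iff trace_sec_def fun_eq_iff)

lemma trace_sec_sections:
  assumes "s \<in> \<Gamma> (alternating_maps k)"
  shows "trace_sec s \<in> \<Gamma> (alternating_maps (k - 1))"
  unfolding trace_sec_def
  using trace_contr_alternating sectionsD(1)[OF assms]
  by (intro sectionsI) (auto simp: trace_contr_def intro!: smooth_sum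
      smooth_linear[OF bounded_linear_inner_left] sectionsD(2)[OF assms])

lemma wedge_sec_sections:
  assumes "s \<in> \<Gamma> (alternating_maps k)"
  shows "wedge_sec s \<in> \<Gamma> (alternating_maps (Suc k))"
  unfolding wedge_sec_def
  using wedge_id_alternating sectionsD(1)[OF assms]
  by (intro sectionsI) (auto simp: wedge_id_def intro!: smooth_alternate
      smooth_linear[OF bounded_linear_scaleR_left] sectionsD(2)[OF assms])

lemma trace_sec_wedge_sec:
  fixes s :: "'v::euclidean_space \<Rightarrow> 'v list \<Rightarrow> real"
  assumes "s \<in> \<Gamma> (alternating_maps k)"
  shows "trace_sec (wedge_sec s) = (\<lambda>x ws. (real DIM('v) - real k) * s x ws)"
  by (intro ext) (simp add: trace_sec_def wedge_sec_def trace_contr_wedge_id[OF sectionsD(1)[OF assms]])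

lemma trace_sec_euler_contr:
  "s \<in> \<Gamma> (alternating_maps k) \<Longrightarrow> trace_sec (euler_contr s) = - euler_contr (trace_sec s)"
  by (intro ext) (simp add: trace_sec_def euler_contr_def trace_contr_contr[OF sectionsD(1)])

lemma euler_contr_K_ker:
  assumes "s \<in> \<Gamma> (K_ker k)"
  shows "euler_contr s \<in> \<Gamma> (K_ker (k - 1))"
  using assms euler_contr_sections[of s k] trace_sec_euler_contr[of s k]
  by (auto simp: sections_K_ker euler_contr_def contr_def fun_eq_iff)

lemma sections_add:
  assumes "s \<in> \<Gamma> (alternating_maps k)" "t \<in> \<Gamma> (alternating_maps k)"
  shows "s + t \<in> \<Gamma> (alternating_maps k)"
proof (rule sectionsI)
  show "(s + t) x \<in> alternating_maps k" for x
    using alternating_sum[of UNIV "\<lambda>i. if i then s x else t x" k] sectionsD(1)[OF assms(1)]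
      sectionsD(1)[OF assms(2)]
    by (simp add: plus_fun_def UNIV_bool add.commute)
qed (simp add: smooth_add sectionsD(2)[OF assms(1)] sectionsD(2)[OF assms(2)])

lemma sections_scale:
  assumes "s \<in> \<Gamma> (alternating_maps k)"
  shows "(\<lambda>x ws. c *\<^sub>R s x ws) \<in> \<Gamma> (alternating_maps k)"
  by (intro sectionsI alternating_maps_linear_comp[OF sectionsD(1)[OF assms]]
      smooth_linear[OF bounded_linear_scaleR_right] sectionsD(2)[OF assms])
     (simp add: linear_iff algebra_simps)

lemma euler_contr_add: "euler_contr (s + t) = euler_contr s + euler_contr t"
  by (simp add: euler_contr_def contr_def fun_eq_iff)

lemma euler_contr_scale:
  "euler_contr (\<lambda>x ws. c *\<^sub>R s x ws) = (\<lambda>x ws. c *\<^sub>R euler_contr s x ws)"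
  by (simp add: euler_contr_def contr_def)

text \<open>
  The wedge with the identity, divided by the nonzero constant \<open>n - k\<close>, is a right inverse.
\<close>

lemma trace_sec_surjective:
  fixes u :: "'v::euclidean_space \<Rightarrow> 'v list \<Rightarrow> real"
  assumes u: "u \<in> \<Gamma> (alternating_maps k)" and k: "k < DIM('v)"
  shows "\<exists>r \<in> \<Gamma> (alternating_maps (Suc k)). trace_sec r = u"
proof
  let ?c = "1 / (real DIM('v) - real k)"
  have u': "(\<lambda>x ws. ?c *\<^sub>R u x ws) \<in> \<Gamma> (alternating_maps k)"
    by (rule sections_scale[OF u])
  then show "wedge_sec (\<lambda>x ws. ?c *\<^sub>R u x ws) \<in> \<Gamma> (alternating_maps (Suc k))"
    by (rule wedge_sec_sections)
  show "trace_sec (wedge_sec (\<lambda>x ws. ?c *\<^sub>R u x ws)) = u"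
    unfolding trace_sec_wedge_sec[OF u'] using k by simp
qed

text \<open>
  The part of the diagram chase common to all places. A primitive \<open>t\<close> of \<open>s\<close> exists in the \<open>V\<close>-valued Koszul
  complex but need not be traceless. Since \<open>s\<close> is, the trace of \<open>t\<close> is a cycle in the scalar Koszul complex,
  hence a boundary \<open>\<iota>\<^sub>E u\<close>.
\<close>

lemma primitive_with_boundary_trace:
  assumes s: "s \<in> \<Gamma> (K_ker k)" and "k > 0" and ker: "euler_contr s = 0"
  obtains t u where "t \<in> \<Gamma> (alternating_maps (Suc k))" "euler_contr t = s"
    "u \<in> \<Gamma> (ext_power (Suc k))" "euler_contr u = trace_sec t"
proof -
  from s have s': "s \<in> \<Gamma> (alternating_maps k)" and tr: "trace_sec s = 0"
    by (auto simp: sections_K_ker)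
  obtain t where t: "t \<in> \<Gamma> (alternating_maps (Suc k))" "euler_contr t = s"
    using koszul_exact[OF s' \<open>k > 0\<close> ker] by blast
  have "euler_contr (trace_sec t) = 0"
    using trace_sec_euler_contr[OF t(1)] t(2) tr by (metis minus_equation_iff minus_zero)
  moreover have "trace_sec t \<in> \<Gamma> (alternating_maps k)"
    using trace_sec_sections[OF t(1)] by simp
  ultimately obtain u where "u \<in> \<Gamma> (alternating_maps (Suc k))" "euler_contr u = trace_sec t"
    using koszul_exact \<open>k > 0\<close> by blast
  with t that show ?thesis by (simp add: ext_power_def)
qed

text \<open>
  Lift the form \<open>u\<close> of \<open>primitive_with_boundary_trace\<close> to \<open>r\<close> with trace \<open>u\<close>, which the degree bound permits. Adding the
  boundary \<open>\<iota>\<^sub>E r\<close> to \<open>t\<close> leaves \<open>\<iota>\<^sub>E t = s\<close> unchanged and cancels the trace, the contraction and the trace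
  being anticommuting.
\<close>

lemma kernel_complex_exact:
  fixes s :: "'v::euclidean_space \<Rightarrow> 'v list \<Rightarrow> 'v"
  assumes s: "s \<in> \<Gamma> (K_ker k)" and k: "0 < k" "Suc k < DIM('v)" and ker: "euler_contr s = 0"
  shows "\<exists>t \<in> \<Gamma> (K_ker (Suc k)). euler_contr t = s"
proof -
  obtain t u where t: "t \<in> \<Gamma> (alternating_maps (Suc k))" "euler_contr t = s"
    and u: "u \<in> \<Gamma> (ext_power (Suc k))" "euler_contr u = trace_sec t"
    using primitive_with_boundary_trace[OF s k(1) ker] by blast
  obtain r where r: "r \<in> \<Gamma> (alternating_maps (Suc (Suc k)))" "trace_sec r = u"
    using trace_sec_surjective[of u "Suc k"] u(1) k(2) by (auto simp: ext_power_def)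
  have er: "euler_contr r \<in> \<Gamma> (alternating_maps (Suc k))"
    using euler_contr_sections[OF r(1)] by simp
  have "trace_sec (t + euler_contr r) = trace_sec t + trace_sec (euler_contr r)"
    by (simp add: trace_sec_def trace_contr_def fun_eq_iff inner_add_left sum.distrib)
  also have "\<dots> = 0"
    using trace_sec_euler_contr[OF r(1)] r(2) u(2) by simp
  finally have "t + euler_contr r \<in> \<Gamma> (K_ker (Suc k))"
    using sections_add[OF t(1) er] by (simp add: sections_K_ker)
  moreover have "euler_contr (t + euler_contr r) = s"
    using t(2) euler_contr_euler_contr[OF r(1)] by (simp add: euler_contr_add)
  ultimately show ?thesis by blast
qed

text \<open>
  In top degree the wedge with the identity is a two-sided inverse of the trace contraction; the right inverse
  carries the factor \<open>n - (n - 1) = 1\<close>. This explicit formula also shows that the inverse preserves smoothness.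
\<close>

lemma phi_inv_top:
  fixes u :: "'v::euclidean_space \<Rightarrow> 'v list \<Rightarrow> real"
  assumes u: "u \<in> \<Gamma> (alternating_maps (DIM('v) - 1))"
  shows "phi_inv DIM('v) u = wedge_sec (\<lambda>x ws. (-1) ^ (DIM('v) - 1) *\<^sub>R u x ws)"
proof
  fix x
  let ?n = "DIM('v)" let ?u = "\<lambda>x ws. (-1) ^ (?n - 1) *\<^sub>R u x ws"
  have u': "?u \<in> \<Gamma> (alternating_maps (?n - 1))"
    by (rule sections_scale[OF u])
  have inj: "inj_on (phi ?n) (ext_power_tensor ?n :: ('v list \<Rightarrow> 'v) set)"
  proof (rule inj_onI)
    fix S T :: "'v list \<Rightarrow> 'v"
    assume "S \<in> ext_power_tensor ?n" "T \<in> ext_power_tensor ?n" "phi ?n S = phi ?n T"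
    moreover from this have "trace_contr S = trace_contr T"
      by (simp add: phi_eq fun_eq_iff)
    ultimately show "S = T"
      using wedge_id_trace_contr by (metis ext_power_tensor_def)
  qed
  have "phi ?n (wedge_sec ?u x) = u x"
    using DIM_positive[where 'a='v] fun_cong[OF trace_sec_wedge_sec[OF u'], of x]
    by (simp add: phi_eq trace_sec_def of_nat_diff flip: mult.assoc power_mult_distrib)
  moreover have "wedge_sec ?u x \<in> ext_power_tensor ?n"
    using sectionsD(1)[OF wedge_sec_sections[OF u']] by (simp add: ext_power_tensor_def)
  ultimately show "phi_inv ?n u x = wedge_sec ?u x"
    unfolding phi_inv_def by (intro inv_into_f_eq inj)
qed

text \<open>
  The first map of the sequence is, up to sign, the connecting homomorphism of the short exact sequence of complexes:
  it sends \<open>u\<close> to \<open>\<iota>\<^sub>E t\<close>, where \<open>t\<close> is the unique top degree section with trace \<open>\<plusminus>\<iota>\<^sub>E u\<close>.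
\<close>

lemma connecting_map:
  fixes u :: "'v::euclidean_space \<Rightarrow> 'v list \<Rightarrow> real"
  assumes u: "u \<in> \<Gamma> (ext_power DIM('v))"
  defines "t \<equiv> phi_inv DIM('v) (bdry u)"
  shows "t \<in> \<Gamma> (alternating_maps DIM('v))"
    and "trace_sec t = (\<lambda>x ws. (-1) ^ DIM('v) *\<^sub>R euler_contr u x ws)"
    and "(d_map \<circ> phi_inv DIM('v) \<circ> bdry) u = euler_contr t"
proof -
  let ?n = "DIM('v)" let ?v = "\<lambda>x ws. (-1) ^ ?n *\<^sub>R euler_contr u x ws"
  have u': "u \<in> \<Gamma> (alternating_maps ?n)" using u by (simp add: ext_power_def)
  note e = euler_contr_sections[OF u']
  have "bdry u = (\<lambda>x ws. (-1) *\<^sub>R euler_contr u x ws)"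
    by (simp add: bdry_eq_euler_contr[OF u'] fun_eq_iff)
  moreover have "(-1 :: real) ^ (?n - 1) * - 1 = (-1) ^ ?n"
    using DIM_positive[where 'a='v] by (cases ?n) auto
  ultimately have t: "t = wedge_sec ?v"
    using phi_inv_top[OF sections_scale[OF e, of "-1"]] by (simp only: t_def scaleR_scaleR)
  have v: "?v \<in> \<Gamma> (alternating_maps (?n - 1))"
    by (rule sections_scale[OF e])
  show t_in: "t \<in> \<Gamma> (alternating_maps ?n)"
    using wedge_sec_sections[OF v] by (simp add: t)
  show "trace_sec t = ?v"
    unfolding t trace_sec_wedge_sec[OF v] using DIM_positive[where 'a='v]
    by (simp add: of_nat_diff)
  show "(d_map \<circ> phi_inv ?n \<circ> bdry) u = euler_contr t"
    using d_map_eq_euler_contr[OF t_in] by (simp add: t_def)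
qed

lemma trace_sec_injective_top:
  fixes t :: "'v::euclidean_space \<Rightarrow> 'v list \<Rightarrow> 'v"
  assumes "s \<in> \<Gamma> (alternating_maps DIM('v))" "t \<in> \<Gamma> (alternating_maps DIM('v))"
    and "trace_sec s = trace_sec t"
  shows "s = t"
proof
  fix x
  have "trace_contr (s x) = trace_contr (t x)"
    using fun_cong[OF assms(3), of x] by (simp add: trace_sec_def)
  then show "s x = t x"
    using wedge_id_trace_contr[OF sectionsD(1)[OF assms(1)], of x]
      wedge_id_trace_contr[OF sectionsD(1)[OF assms(2)], of x] by metis
qed

lemma connecting_map_K_ker:
  fixes u :: "'v::euclidean_space \<Rightarrow> 'v list \<Rightarrow> real"
  assumes u: "u \<in> \<Gamma> (ext_power DIM('v))"
  shows "(d_map \<circ> phi_inv DIM('v) \<circ> bdry) u \<in> \<Gamma> (K_ker (DIM('v) - 1))"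
    "euler_contr ((d_map \<circ> phi_inv DIM('v) \<circ> bdry) u) = 0"
proof -
  note f = connecting_map[OF u]
  have "euler_contr (euler_contr u) = 0"
    using u euler_contr_euler_contr by (auto simp: ext_power_def)
  then have "trace_sec (euler_contr (phi_inv DIM('v) (bdry u))) = 0"
    unfolding trace_sec_euler_contr[OF f(1)] f(2) euler_contr_scale by (simp add: fun_eq_iff)
  then show "(d_map \<circ> phi_inv DIM('v) \<circ> bdry) u \<in> \<Gamma> (K_ker (DIM('v) - 1))"
    using euler_contr_sections[OF f(1)] by (simp only: f(3) sections_K_ker)
  show "euler_contr ((d_map \<circ> phi_inv DIM('v) \<circ> bdry) u) = 0"
    by (simp only: f(3) euler_contr_euler_contr[OF f(1)])
qed

text \<open>
  Both \<open>\<iota>\<^sub>E t = 0\<close> and then \<open>\<iota>\<^sub>E u = 0\<close> force vanishing, as \<open>t\<close> and \<open>u\<close> have top degree.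
\<close>

lemma connecting_map_injective:
  fixes u :: "'v::euclidean_space \<Rightarrow> 'v list \<Rightarrow> real"
  assumes u: "u \<in> \<Gamma> (ext_power DIM('v))" and 0: "(d_map \<circ> phi_inv DIM('v) \<circ> bdry) u = 0"
  shows "u = 0"
proof -
  note f = connecting_map[OF u]
  have "phi_inv DIM('v) (bdry u) = 0"
    using koszul_exact_top[OF f(1)] f(3) 0 by simp
  then have "euler_contr u = 0"
    using f(2) by (simp add: trace_sec_def trace_contr_def fun_eq_iff)
  then show ?thesis
    using koszul_exact_top u by (auto simp: ext_power_def)
qed

text \<open>
  Here the form \<open>u\<close> of \<open>primitive_with_boundary_trace\<close> has degree \<open>n\<close>, while there are no nonzero \<open>V\<close>-valued forms of
  degree \<open>n + 1\<close> to lift it to. Instead, the primitive \<open>t\<close> is the only top degree section with trace \<open>\<iota>\<^sub>E u\<close>, so \<open>s\<close> is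
  the image of \<open>\<plusminus>u\<close>.
\<close>

lemma connecting_map_onto_kernel:
  fixes s :: "'v::euclidean_space \<Rightarrow> 'v list \<Rightarrow> 'v"
  assumes s: "s \<in> \<Gamma> (K_ker (DIM('v) - 1))" and n: "2 \<le> DIM('v)" and ker: "euler_contr s = 0"
  shows "\<exists>u \<in> \<Gamma> (ext_power DIM('v)). (d_map \<circ> phi_inv DIM('v) \<circ> bdry) u = s"
proof -
  let ?n = "DIM('v)"
  have "0 < ?n - 1" "Suc (?n - 1) = ?n" using n by auto
  then obtain t u where t: "t \<in> \<Gamma> (alternating_maps ?n)" "euler_contr t = s"
    and u: "u \<in> \<Gamma> (ext_power ?n)" "euler_contr u = trace_sec t"
    using primitive_with_boundary_trace[OF s _ ker] by metis
  let ?u = "\<lambda>x ws. (-1) ^ ?n *\<^sub>R u x ws"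
  have u': "?u \<in> \<Gamma> (ext_power ?n)"
    using sections_scale u(1) unfolding ext_power_def by blast
  note f = connecting_map[OF u']
  have "trace_sec (phi_inv ?n (bdry ?u)) = trace_sec t"
    unfolding f(2) euler_contr_scale u(2) by (simp flip: mult.assoc power_mult_distrib)
  then have "phi_inv ?n (bdry ?u) = t"
    by (rule trace_sec_injective_top[OF f(1) t(1)])
  then show ?thesis using f(3) t(2) u' by metis
qed

theorem proposition2p6:
  fixes n :: nat
  assumes "DIM('v::euclidean_space) = n" and "n \<ge> 2"
  shows
    "exact_at {0 :: real} (\<lambda>_. 0)
       (\<Gamma> (ext_power n)) (d_map \<circ> phi_inv n \<circ> bdry)
       (\<Gamma> (K_ker (n - 1)) :: ('v \<Rightarrow> 'v list \<Rightarrow> 'v) set) \<and>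
     (n = 2 \<longrightarrow>
       exact_at (\<Gamma> (ext_power n)) (d_map \<circ> phi_inv n \<circ> bdry)
         (\<Gamma> (K_ker 1)) rho
         (F_mu :: ('v \<Rightarrow> 'v) set)) \<and>
     (n \<ge> 3 \<longrightarrow>
       exact_at (\<Gamma> (ext_power n)) (d_map \<circ> phi_inv n \<circ> bdry)
         (\<Gamma> (K_ker (n - 1))) d_map
         (\<Gamma> (K_ker (n - 2)) :: ('v \<Rightarrow> 'v list \<Rightarrow> 'v) set) \<and>
       (\<forall>k. 2 \<le> k \<and> k \<le> n - 2 \<longrightarrow>
         exact_at (\<Gamma> (K_ker (k + 1))) d_map
           (\<Gamma> (K_ker k)) d_map
           (\<Gamma> (K_ker (k - 1)) :: ('v \<Rightarrow> 'v list \<Rightarrow> 'v) set)) \<and>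
       exact_at (\<Gamma> (K_ker 2)) d_map
         (\<Gamma> (K_ker 1)) rho
         (F_mu :: ('v \<Rightarrow> 'v) set)) \<and>
     exact_at (\<Gamma> (K_ker 1)) rho
       (F_mu :: ('v \<Rightarrow> 'v) set) (\<lambda>_. 0)
       {0 :: real}"
proof -
  let ?D = "d_map \<circ> phi_inv n \<circ> bdry :: ('v \<Rightarrow> 'v list \<Rightarrow> real) \<Rightarrow> 'v \<Rightarrow> 'v list \<Rightarrow> 'v"
  let ?K = "\<lambda>k. \<Gamma> (K_ker k) :: ('v \<Rightarrow> 'v list \<Rightarrow> 'v) set"
  have d: "d_map s = euler_contr s" if "s \<in> ?K k" for s k
    using that d_map_eq_euler_contr by (auto simp: sections_K_ker)
  have r: "rho s = 0 \<longleftrightarrow> euler_contr s = 0" if "s \<in> ?K 1" for s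
    using that rho_eq_0_iff by (auto simp: sections_K_ker)
  have F: "F_mu = rho ` ?K 1"
    unfolding F_mu_def K_ker_1_eq_sl ..
  have zero: "(0 :: 'v \<Rightarrow> 'v list \<Rightarrow> real) \<in> \<Gamma> (ext_power n)"
    by (intro sectionsI) (simp_all add: ext_power_def alternating_maps_def smooth_const linear_iff)
  have D0: "?D 0 = 0"
  proof -
    have b: "bdry 0 = (0 :: 'v \<Rightarrow> 'v list \<Rightarrow> real)"
      by (simp add: bdry_def contr_def fun_eq_iff)
    have "(0 :: 'v \<Rightarrow> 'v list \<Rightarrow> real) \<in> \<Gamma> (alternating_maps (DIM('v) - 1))"
      by (intro sectionsI) (simp_all add: alternating_maps_def smooth_const linear_iff)
    then have "phi_inv n (0 :: 'v \<Rightarrow> 'v list \<Rightarrow> real) = 0"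
      using phi_inv_top[of "0 :: 'v \<Rightarrow> 'v list \<Rightarrow> real"] assms(1)
      by (simp add: wedge_sec_def wedge_id_def fun_eq_iff)
    then show ?thesis
      by (simp add: b d_map_def contr_def fun_eq_iff)
  qed
  have image_D: "?D ` \<Gamma> (ext_power n) = {s \<in> ?K (n - 1). euler_contr s = 0}"
    using connecting_map_K_ker connecting_map_onto_kernel assms by blast
  have image_d: "d_map ` ?K (Suc k) = {s \<in> ?K k. euler_contr s = 0}" if k: "0 < k" "Suc k < n" for k
  proof (intro equalityI subsetI)
    fix s assume "s \<in> d_map ` ?K (Suc k)"
    then obtain t where t: "t \<in> ?K (Suc k)" "s = euler_contr t" using d by auto
    then show "s \<in> {s \<in> ?K k. euler_contr s = 0}"
      using euler_contr_K_ker[OF t(1)] euler_contr_euler_contr by (auto simp: sections_K_ker)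
  next
    fix s assume "s \<in> {s \<in> ?K k. euler_contr s = 0}"
    then obtain t where "t \<in> ?K (Suc k)" "euler_contr t = s"
      using kernel_complex_exact[of s k] k assms(1) by auto
    then show "s \<in> d_map ` ?K (Suc k)" using d by (metis image_eqI)
  qed
  have d_K: "d_map ` ?K k \<subseteq> ?K (k - 1)" for k
    using d euler_contr_K_ker by fastforce
  have "exact_at {0 :: real} (\<lambda>_. 0) (\<Gamma> (ext_power n)) ?D (?K (n - 1))"
    unfolding exact_at_def
    using zero D0 image_D connecting_map_injective assms(1) by auto
  moreover have "exact_at (\<Gamma> (ext_power n)) ?D (?K 1) rho F_mu" if "n = 2"
    using image_D that r F by (auto simp: exact_at_def)
  moreover have "exact_at (\<Gamma> (ext_power n)) ?D (?K (n - 1)) d_map (?K (n - 2))"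
    using image_D d d_K[of "n - 1"] by (auto simp: exact_at_def numeral_2_eq_2)
  moreover have "exact_at (?K (k + 1)) d_map (?K k) d_map (?K (k - 1))"
    if "2 \<le> k" "k \<le> n - 2" for k
    using image_d[of k] that d d_K[of k] by (auto simp: exact_at_def)
  moreover have "exact_at (?K 2) d_map (?K 1) rho F_mu" if "n \<ge> 3"
    using image_d[of 1] that r F by (auto simp: exact_at_def numeral_2_eq_2)
  moreover have "exact_at (?K 1) rho F_mu (\<lambda>_. 0) {0 :: real}"
    using F by (auto simp: exact_at_def)
  ultimately show ?thesis by blast
qed

end
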